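(* If there exists a $\Gamma$-competitive algorithm for all finite support instances of the order selection prophet inequality, then there also exists a $\Gamma$-ASD algorithm for all finite support instances of the order selection prophet inequality.
   Context: Order selection prophet inequality: an instance consists of $n>1$ items with independent non-negative values $v_i\sim D_i$, with the $D_i$ known to the algorithm; it is a finite support instance if every $D_i$ has finite support. The algorithm (possibly randomized) chooses the arrival order of the items; when an item arrives its value is revealed and the algorithm must irrevocably accept it (receiving its value and stopping) or reject it. $\mathrm{ALG}$ denotes the accepted value (0 if none). An algorithm is $\Gamma$-competitive (on a class of instances) if $\mathbb{E}[\mathrm{ALG}]\ge\Gamma\,\mathbb{E}[\max_i v_i]$ on every instance of the class. An algorithm is $\Gamma$-ASD ($\Gamma$-approximate stochastic dominance) if $\mathbb{P}[\mathrm{ALG}>x]\ge \Gamma\cdot\mathbb{P}[\max_i v_i>x]$ for all $x>0$, on every instance of the class. *)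

theory Defs
  imports "HOL-Probability.Probability"
begin

text \<open>An instance is the list of the value distributions. A distribution on the reals with finite
  support is the same thing as a \<open>pmf\<close> with a finite \<open>set_pmf\<close>.\<close>

type_synonym inst = "real pmf list"

definition finite_support_instance :: "inst \<Rightarrow> bool" where
  "finite_support_instance I \<longleftrightarrow>
     length I > 1 \<and> (\<forall>D\<in>set I. finite (set_pmf D) \<and> set_pmf D \<subseteq> {0..})"

text \<open>The default value \<open>0\<close> only concerns indices outside \<open>{..<length I}\<close>.\<close>

definition values_pmf :: "inst \<Rightarrow> (nat \<Rightarrow> real) pmf" where
  "values_pmf I = Pi_pmf {..<length I} 0 (\<lambda>i. I ! i)"

definition max_pmf :: "inst \<Rightarrow> real pmf" where
  "max_pmf I = map_pmf (\<lambda>v. Max (v ` {..<length I})) (values_pmf I)"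

text \<open>A history lists the items that have arrived (and been rejected) so far together with their
  revealed values, in order of arrival.\<close>

type_synonym history = "(nat \<times> real) list"

text \<open>A deterministic online policy. Given the history \<open>h\<close>, the next item to arrive is
  \<open>next_item p h\<close>, and it is accepted iff \<open>accepts p h x\<close>, where \<open>x\<close> is its revealed value. The order
  may be adaptive; fixing it in advance is the case where \<open>next_item p h\<close> depends only on \<open>length h\<close>.\<close>

datatype policy =
  Policy (next_item: "history \<Rightarrow> nat") (accepts: "history \<Rightarrow> real \<Rightarrow> bool")

definition valid_policy :: "nat \<Rightarrow> policy \<Rightarrow> bool" where
  "valid_policy n p \<longleftrightarrow>
     (\<forall>h. {..<n} - fst ` set h \<noteq> {} \<longrightarrow> next_item p h \<in> {..<n} - fst ` set h)"

text \<open>\<open>run p k h v\<close> is the value obtained from the last \<open>k\<close> arrivals, after history \<open>h\<close>, on the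
  realization \<open>v\<close>.\<close>

fun run :: "policy \<Rightarrow> nat \<Rightarrow> history \<Rightarrow> (nat \<Rightarrow> real) \<Rightarrow> real" where
  "run p 0 h v = 0"
| "run p (Suc k) h v =
     (let i = next_item p h
      in if accepts p h (v i) then v i else run p k (h @ [(i, v i)]) v)"

text \<open>A randomized algorithm knows the instance and draws a deterministic policy, independently of the
  values. On a finite support instance only finitely many histories can occur, so discrete
  randomization loses no generality.\<close>

type_synonym algorithm = "inst \<Rightarrow> policy pmf"

definition order_selection_algorithm :: "algorithm \<Rightarrow> bool" where
  "order_selection_algorithm A \<longleftrightarrow>
     (\<forall>I. finite_support_instance I \<longrightarrow> (\<forall>p\<in>set_pmf (A I). valid_policy (length I) p))"

definition alg_pmf :: "algorithm \<Rightarrow> inst \<Rightarrow> real pmf" where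
  "alg_pmf A I =
     map_pmf (\<lambda>(p, v). run p (length I) [] v) (pair_pmf (A I) (values_pmf I))"

definition competitive :: "real \<Rightarrow> algorithm \<Rightarrow> bool" where
  "competitive \<Gamma> A \<longleftrightarrow>
     (\<forall>I. finite_support_instance I \<longrightarrow>
        measure_pmf.expectation (alg_pmf A I) (\<lambda>x. x)
          \<ge> \<Gamma> * measure_pmf.expectation (max_pmf I) (\<lambda>x. x))"

definition ASD :: "real \<Rightarrow> algorithm \<Rightarrow> bool" where
  "ASD \<Gamma> A \<longleftrightarrow>
     (\<forall>I. finite_support_instance I \<longrightarrow>
        (\<forall>x>0. measure_pmf.prob (alg_pmf A I) {x<..}
                 \<ge> \<Gamma> * measure_pmf.prob (max_pmf I) {x<..}))"

end

theory Submission imports Defs begin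

text \<open>Fix an instance and let \<open>s\<close> range over its finitely many possible values. For weights
  \<open>w\<^sub>s \<ge> 0\<close> the function \<open>f y = (\<Sum>s. w\<^sub>s [y > s])\<close> is monotone with \<open>f 0 = 0\<close>, so it commutes with the
  maximum, and the competitive algorithm, run on the instance with values \<open>f (v i)\<close>, yields a policy for
  the original instance whose expected value of \<open>f\<close> is at least \<open>\<Gamma>\<close> times that of the maximum. This is
  the stochastic dominance inequality averaged over the thresholds \<open>s\<close> with weights \<open>w\<close>. As policies
  have only finitely many outcome distributions, the minimax theorem turns this into one randomized
  policy that satisfies the inequality at every threshold.\<close>

section \<open>A finite minimax theorem by quadratic penalty\<close>

text \<open>Pinning the coordinates outside \<open>P\<close> to 0 makes the set a closed subset of a
  product of compact sets, so Tychonoff applies even when the index type is infinite.\<close>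

lemma compact_simplex:
  fixes P :: "'a set"
  assumes "finite P"
  shows "compact {q. (\<forall>p. q p \<ge> (0::real)) \<and> (\<forall>p. p \<notin> P \<longrightarrow> q p = 0) \<and> sum q P = 1}"
    (is "compact ?S")
proof -
  let ?B = "PiE UNIV (\<lambda>p. if p \<in> P then {0..1::real} else {0})"
  have "compactin (product_topology (\<lambda>_. euclidean) UNIV) ?B"
    by (subst compactin_PiE) auto
  then have cB: "compact ?B"
    by (simp add: euclidean_product_topology)
  have "closed ((\<lambda>q. sum q P) -` {1::real})"
    by (intro closed_vimage continuous_on_sum continuous_on_product_coordinates) auto
  then have "compact (?B \<inter> (\<lambda>q. sum q P) -` {1::real})"
    by (rule compact_Int_closed[OF cB])
  also have "?B \<inter> (\<lambda>q. sum q P) -` {1::real} = ?S"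
  proof (intro equalityI subsetI)
    fix q assume q: "q \<in> ?B \<inter> (\<lambda>q. sum q P) -` {1::real}"
    have *: "q p \<in> (if p \<in> P then {0..1} else {0})" for p
      by (rule PiE_mem[OF IntD1[OF q] UNIV_I])
    have "q p \<ge> 0" "p \<notin> P \<longrightarrow> q p = 0" for p
      using *[of p] by (auto split: if_splits)
    then show "q \<in> ?S"
      using q by auto
  next
    fix q assume q: "q \<in> ?S"
    then have "q p \<le> 1" if "p \<in> P" for p
      using member_le_sum[of p P q] that assms by auto
    then show "q \<in> ?B \<inter> (\<lambda>q. sum q P) -` {1::real}"
      using q by (auto simp: PiE_UNIV_domain)
  qed
  finally show ?thesis .
qed

text \<open>For a \<le> 0 the right side is (a + d)^2, for a > 0 it is d^2. The first-order
  coefficient \<open>2 * min 0 a\<close> is the derivative of the squared negative part.\<close>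

lemma min_0_square_smooth:
  fixes a d :: real
  shows "(min 0 (a + d))\<^sup>2 \<le> (min 0 a)\<^sup>2 + 2 * min 0 a * d + d\<^sup>2"
proof -
  consider "a \<le> 0" "a + d \<le> 0" | "a \<le> 0" "a + d > 0" | "a > 0" "a + d > 0" | "a > 0" "a + d \<le> 0"
    by linarith
  then show ?thesis
  proof cases
    case 2
    have "0 \<le> (a + d)\<^sup>2" by simp
    with 2 show ?thesis by (simp add: min_def power2_eq_square algebra_simps)
  next
    case 4
    then have "\<bar>a + d\<bar> \<le> \<bar>d\<bar>" by linarith
    then have "(a + d)\<^sup>2 \<le> d\<^sup>2" by (simp only: abs_le_square_iff)
    with 4 show ?thesis by (auto simp: min_def)
  qed (auto simp: min_def power2_eq_square algebra_simps)
qed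

text \<open>A mixed strategy \<open>q\<close> that minimizes the sum of the squared negative parts of the payoffs
  \<open>u q j\<close> works: moving \<open>q\<close> towards a response to the weights \<open>w j = - min 0 (u q j)\<close> would decrease
  that sum to first order if it were positive.\<close>

lemma minimax_weights:
  fixes M :: "'p \<Rightarrow> 'j \<Rightarrow> real"
  assumes fin: "finite P" "finite J"
    and resp: "\<And>w. (\<And>j. w j \<ge> 0) \<Longrightarrow> \<exists>p\<in>P. (\<Sum>j\<in>J. w j * M p j) \<ge> 0"
  obtains q where "\<And>p. q p \<ge> 0" "\<And>p. p \<notin> P \<Longrightarrow> q p = 0" "sum q P = 1"
    "\<And>j. j \<in> J \<Longrightarrow> (\<Sum>p\<in>P. q p * M p j) \<ge> 0"
proof -
  define S where "S = {q. (\<forall>p. q p \<ge> (0::real)) \<and> (\<forall>p. p \<notin> P \<longrightarrow> q p = 0) \<and> sum q P = 1}"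
  define u where "u q j = (\<Sum>p\<in>P. q p * M p j)" for q :: "'p \<Rightarrow> real" and j
  define \<Phi> where "\<Phi> q = (\<Sum>j\<in>J. (min 0 (u q j))\<^sup>2)" for q
  have "compact S"
    unfolding S_def by (rule compact_simplex[OF fin(1)])
  moreover have pt: "(\<lambda>x. if x = p then 1 else 0) \<in> S" if "p \<in> P" for p
    using that fin by (auto simp: S_def)
  \<comment> \<open>The response to zero weights shows that \<open>P\<close> has an element.\<close>
  then have "S \<noteq> {}"
    using resp[of "\<lambda>_. 0"] by auto
  moreover have "continuous_on S \<Phi>"
    unfolding \<Phi>_def u_def
    by (intro continuous_intros continuous_on_subset[OF continuous_on_product_coordinates]) auto
  ultimately obtain q where q: "q \<in> S" and min: "\<And>r. r \<in> S \<Longrightarrow> \<Phi> q \<le> \<Phi> r"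
    using continuous_attains_inf by metis
  obtain p where p: "p \<in> P" and "0 \<le> (\<Sum>j\<in>J. - min 0 (u q j) * M p j)"
    using resp[of "\<lambda>j. - min 0 (u q j)"] by auto
  then have slope: "(\<Sum>j\<in>J. min 0 (u q j) * M p j) \<le> 0"
    by (simp add: sum_negf)
  define C where "C = (\<Sum>j\<in>J. (M p j - u q j)\<^sup>2)"
  \<comment> \<open>Second-order expansion of \<open>\<Phi>\<close> at
    \<open>(1 - t) * q + t * p\<close>: by minimality the first-order decrease, at least
    \<open>2 * t * \<Phi> q\<close>, cannot exceed the remainder of order t^2.\<close>
  have bound: "2 * \<Phi> q \<le> t * C" if t: "0 < t" "t \<le> 1" for t
  proof -
    define r where "r x = q x + t * ((if x = p then 1 else 0) - q x)" for x
    have "r x = (1 - t) * q x + t * (if x = p then 1 else 0)" for x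
      by (auto simp: r_def algebra_simps)
    then have "r \<in> S"
      using q t p fin by (auto simp: S_def sum.distrib simp flip: sum_distrib_left)
    have u_r: "u r j = u q j + t * (M p j - u q j)" for j
    proof -
      have "u r j = (\<Sum>x\<in>P. q x * M x j + (t * (if x = p then M x j else 0) - t * (q x * M x j)))"
        unfolding u_def r_def by (intro sum.cong) (auto simp: algebra_simps)
      also have "\<dots> = u q j + (t * M p j - t * u q j)"
        unfolding u_def using p fin
        by (simp add: sum.distrib sum_subtractf flip: sum_distrib_left)
      finally show ?thesis by (simp add: algebra_simps)
    qed
    have "\<Phi> q \<le> \<Phi> r" by (rule min[OF \<open>r \<in> S\<close>])
    also have "\<dots> \<le> (\<Sum>j\<in>J. (min 0 (u q j))\<^sup>2 + 2 * min 0 (u q j) * (t * (M p j - u q j))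
        + (t * (M p j - u q j))\<^sup>2)"
      unfolding \<Phi>_def u_r by (intro sum_mono min_0_square_smooth)
    \<comment> \<open>Here \<open>min 0 a * a\<close> equals (min 0 a)^2, which makes
      \<open>\<Phi> q\<close> reappear in the linear term.\<close>
    also have "\<dots> = (\<Sum>j\<in>J. (min 0 (u q j))\<^sup>2 + (2 * t) * (min 0 (u q j) * M p j)
        - (2 * t) * (min 0 (u q j))\<^sup>2 + t\<^sup>2 * (M p j - u q j)\<^sup>2)"
      by (intro sum.cong) (auto simp: min_def power2_eq_square algebra_simps)
    also have "\<dots> = \<Phi> q + (2 * t) * (\<Sum>j\<in>J. min 0 (u q j) * M p j) - (2 * t) * \<Phi> q + t\<^sup>2 * C"
      unfolding \<Phi>_def C_def by (simp add: sum.distrib sum_subtractf sum_distrib_left)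
    also have "\<dots> \<le> \<Phi> q - (2 * t) * \<Phi> q + t\<^sup>2 * C"
      using mult_nonneg_nonpos[OF _ slope, of "2 * t"] t by simp
    finally have "t * (2 * \<Phi> q) \<le> t * (t * C)"
      by (simp add: power2_eq_square algebra_simps)
    then show ?thesis
      using t by simp
  qed
  have C0: "C \<ge> 0" and Phi0: "\<Phi> q \<ge> 0"
    by (auto simp: C_def \<Phi>_def intro!: sum_nonneg)
  have "\<Phi> q = 0"
  proof (rule ccontr)
    assume "\<Phi> q \<noteq> 0"
    with Phi0 have pos: "\<Phi> q > 0" by simp
    \<comment> \<open>Small enough that t * C \<le> \<open>\<Phi> q\<close> < 2 *
      \<open>\<Phi> q\<close>; the added 1 covers the case C = 0.\<close>
    define t where "t = min 1 (\<Phi> q / (C + 1))"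
    have t: "0 < t" "t \<le> 1" "t \<le> \<Phi> q / (C + 1)"
      using pos C0 by (auto simp: t_def)
    have "t * C \<le> t * (C + 1)" using t by simp
    also have "\<dots> \<le> \<Phi> q" using t(3) C0 by (simp add: pos_le_divide_eq)
    finally show False using bound[OF t(1,2)] pos by simp
  qed
  then have "u q j \<ge> 0" if "j \<in> J" for j
    using that fin unfolding \<Phi>_def
    by (subst (asm) sum_nonneg_eq_0_iff) (auto simp: min_def split: if_splits)
  then show thesis
    using q by (intro that[of q]) (auto simp: S_def u_def)
qed

lemma pmf_of_weights:
  fixes q :: "'a \<Rightarrow> real"
  assumes "finite P" "\<And>p. q p \<ge> 0" "\<And>p. p \<notin> P \<Longrightarrow> q p = 0" "sum q P = 1"
  obtains Q where "pmf Q = q"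
proof -
  have "(\<integral>\<^sup>+x. ennreal (q x) \<partial>count_space UNIV) = (\<integral>\<^sup>+x. ennreal (q x) \<partial>count_space P)"
    using assms(3) by (intro nn_integral_count_space_eq) auto
  also have "\<dots> = ennreal (sum q P)"
    using assms by (simp add: nn_integral_count_space_finite sum_ennreal)
  finally have "(\<integral>\<^sup>+x. ennreal (q x) \<partial>count_space UNIV) = 1"
    using assms by simp
  then have "pmf (embed_pmf q) = q"
    using assms(2) by (intro ext pmf_embed_pmf) auto
  then show thesis by (rule that)
qed

text \<open>\<open>F\<close> may be infinite: strategies with the same payoff row are
  interchangeable, so one representative for each of the finitely many rows suffices.\<close>

lemma minimax_pmf:
  fixes M :: "'p \<Rightarrow> 'j \<Rightarrow> real"
  assumes fin: "finite (M ` F)" "finite J"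
    and resp: "\<And>w. (\<And>j. w j \<ge> 0) \<Longrightarrow> \<exists>p\<in>F. (\<Sum>j\<in>J. w j * M p j) \<ge> 0"
  obtains Q where "finite (set_pmf Q)" "set_pmf Q \<subseteq> F"
    "\<And>j. j \<in> J \<Longrightarrow> measure_pmf.expectation Q (\<lambda>p. M p j) \<ge> 0"
proof -
  obtain P where P: "P \<subseteq> F" "finite P" "M ` F = M ` P"
    using finite_subset_image[OF fin(1) order_refl] by auto
  have "\<exists>p\<in>P. (\<Sum>j\<in>J. w j * M p j) \<ge> 0" if w: "\<And>j. w j \<ge> 0" for w
  proof -
    obtain p where "p \<in> F" "(\<Sum>j\<in>J. w j * M p j) \<ge> 0"
      using resp[of w] w by auto
    moreover obtain p' where "p' \<in> P" "M p = M p'"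
      using \<open>p \<in> F\<close> P(3) by (metis imageE imageI)
    ultimately show ?thesis by auto
  qed
  from minimax_weights[OF P(2) fin(2) this] obtain q
    where q: "\<And>p. q p \<ge> 0" "\<And>p. p \<notin> P \<Longrightarrow> q p = 0" "sum q P = 1"
    and q_ge: "\<And>j. j \<in> J \<Longrightarrow> (\<Sum>p\<in>P. q p * M p j) \<ge> 0"
    by blast
  obtain Q where Q: "pmf Q = q"
    using pmf_of_weights[OF P(2) q] by blast
  have set: "set_pmf Q \<subseteq> P"
    using q(2) Q by (auto simp: set_pmf_eq)
  then have "measure_pmf.expectation Q (\<lambda>p. M p j) = (\<Sum>p\<in>P. q p * M p j)" for j
    by (subst integral_measure_pmf[OF P(2)]) (auto simp: Q)
  with set P q_ge show thesis
    by (intro that[of Q]) (auto intro: finite_subset)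
qed

section \<open>Expectations under mixtures\<close>

lemma expectation_bind_pmf:
  fixes f :: "'b \<Rightarrow> real"
  assumes bd: "\<And>y. y \<in> set_pmf (bind_pmf M N) \<Longrightarrow> \<bar>f y\<bar> \<le> B"
  shows "measure_pmf.expectation (bind_pmf M N) f
    = measure_pmf.expectation M (\<lambda>x. measure_pmf.expectation (N x) f)"
    and "integrable M (\<lambda>x. measure_pmf.expectation (N x) f)"
proof -
  \<comment> \<open>\<open>integral_bind\<close> is applied with a bound valid everywhere, while
    \<open>f\<close> is bounded only on the support; hence the cut-off to 0 elsewhere.\<close>
  define g where "g y = (if y \<in> set_pmf (bind_pmf M N) then f y else 0)" for y
  obtain y where "y \<in> set_pmf (bind_pmf M N)"
    using set_pmf_not_empty[of "bind_pmf M N"] by blast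
  with bd have "B \<ge> 0" by fastforce
  then have g: "\<bar>g y\<bar> \<le> B" for y
    using bd by (auto simp: g_def)
  have inner: "measure_pmf.expectation (N x) g = measure_pmf.expectation (N x) f"
    if "x \<in> set_pmf M" for x
    using that by (intro integral_cong_AE) (auto simp: AE_measure_pmf_iff g_def)
  have "measure_pmf.expectation (bind_pmf M N) f = measure_pmf.expectation (bind_pmf M N) g"
    by (intro integral_cong_AE) (auto simp: AE_measure_pmf_iff g_def simp del: set_bind_pmf)
  also have "\<dots> = measure_pmf.expectation M (\<lambda>x. measure_pmf.expectation (N x) g)"
    unfolding measure_pmf_bind
    by (rule integral_bind[where K = "count_space UNIV" and B = B and B' = 1])
      (auto simp: g measure_pmf.emeasure_space_1 space_subprob_algebra subprob_space_measure_pmf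
        intro: measure_pmf.finite_measure_axioms)
  also have "\<dots> = measure_pmf.expectation M (\<lambda>x. measure_pmf.expectation (N x) f)"
    by (intro integral_cong_AE) (auto simp: AE_measure_pmf_iff inner)
  finally show "measure_pmf.expectation (bind_pmf M N) f
    = measure_pmf.expectation M (\<lambda>x. measure_pmf.expectation (N x) f)" .
  have "\<bar>measure_pmf.expectation (N x) g\<bar> \<le> B" for x
  proof -
    have "integrable (N x) g"
      using g by (intro measure_pmf.integrable_const_bound[where B = B]) auto
    then have "measure_pmf.expectation (N x) (\<lambda>y. \<bar>g y\<bar>) \<le> B"
      using g by (intro measure_pmf.integral_le_const) auto
    then show ?thesis
      using integral_abs_bound[of "measure_pmf (N x)" g] by linarith
  qed
  then have "integrable M (\<lambda>x. measure_pmf.expectation (N x) g)"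
    by (intro measure_pmf.integrable_const_bound[where B = B]) auto
  then show "integrable M (\<lambda>x. measure_pmf.expectation (N x) f)"
    by (subst integrable_cong_AE[of _ _ "\<lambda>x. measure_pmf.expectation (N x) g"])
      (auto simp: AE_measure_pmf_iff inner)
qed

text \<open>If all components lay strictly below the overall mean, so would their average. This
  derandomizes an algorithm for one fixed objective.\<close>

lemma exists_expectation_ge:
  fixes f :: "'b \<Rightarrow> real"
  assumes bd: "\<And>y. y \<in> set_pmf (bind_pmf M N) \<Longrightarrow> \<bar>f y\<bar> \<le> B"
  obtains x where "x \<in> set_pmf M"
    "measure_pmf.expectation (bind_pmf M N) f \<le> measure_pmf.expectation (N x) f"
proof (rule ccontr)
  assume "\<not> thesis"
  with that have "measure_pmf.expectation (N x) f < measure_pmf.expectation (bind_pmf M N) f"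
    if "x \<in> set_pmf M" for x
    using \<open>x \<in> set_pmf M\<close> not_le by blast
  then have "measure_pmf.expectation M (\<lambda>x. measure_pmf.expectation (N x) f)
      < measure_pmf.expectation (bind_pmf M N) f"
    using expectation_bind_pmf(2)[of M N f B, OF bd]
    by (intro measure_pmf.expectation_less) (auto simp: AE_measure_pmf_iff)
  then show False
    using expectation_bind_pmf(1)[of M N f B, OF bd] by linarith
qed

section \<open>Outcome distributions of deterministic policies\<close>

definition outcome :: "inst \<Rightarrow> policy \<Rightarrow> real pmf" where
  "outcome I p = map_pmf (run p (length I) []) (values_pmf I)"

lemma alg_pmf_eq_bind: "alg_pmf A I = bind_pmf (A I) (outcome I)"
  by (simp add: alg_pmf_def outcome_def[abs_def] pair_pmf_def map_bind_pmf map_pmf_def bind_assoc_pmf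
      bind_return_pmf)

text \<open>The element 0 accounts for runs that accept nothing and for the default value at indices
  outside the instance; it also puts a threshold below every positive x.\<close>

definition vals :: "inst \<Rightarrow> real set" where
  "vals I = insert 0 (\<Union>D\<in>set I. set_pmf D)"

lemma finite_vals: "finite_support_instance I \<Longrightarrow> finite (vals I)"
  by (auto simp: finite_support_instance_def vals_def)

lemma vals_nonneg: "finite_support_instance I \<Longrightarrow> x \<in> vals I \<Longrightarrow> 0 \<le> x"
  by (auto simp: finite_support_instance_def vals_def)

lemma values_in_vals:
  assumes "v \<in> set_pmf (values_pmf I)"
  shows "v i \<in> vals I"
  using assms by (cases "i < length I") (auto simp: values_pmf_def set_Pi_pmf PiE_dflt_def vals_def)

lemma finite_set_values_pmf:
  assumes "finite_support_instance I"
  shows "finite (set_pmf (values_pmf I))"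
  using assms by (auto simp: values_pmf_def set_Pi_pmf finite_support_instance_def)

lemma run_in_range: "run p k h v \<in> insert 0 (range v)"
  by (induction k arbitrary: h) (auto simp: Let_def)

lemma set_outcome_subset_vals: "set_pmf (outcome I p) \<subseteq> vals I"
proof
  fix y assume "y \<in> set_pmf (outcome I p)"
  then obtain v where v: "v \<in> set_pmf (values_pmf I)" "y = run p (length I) [] v"
    by (auto simp: outcome_def)
  then have "y = 0 \<or> (\<exists>i. y = v i)"
    using run_in_range[of p "length I" "[]" v] by auto
  then show "y \<in> vals I"
    using values_in_vals[OF v(1)] by (auto simp: vals_def)
qed

text \<open>There are infinitely many policies, but an outcome depends only on \<open>run\<close>
  restricted to the support of \<open>values_pmf I\<close>, a map between finite sets.\<close>

lemma finite_range_outcome: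
  assumes "finite_support_instance I"
  shows "finite (range (outcome I))"
proof -
  let ?V = "set_pmf (values_pmf I)"
  let ?r = "\<lambda>p. restrict (run p (length I) []) ?V"
  have "run p (length I) [] v \<in> vals I" if "v \<in> ?V" for p v
    using set_outcome_subset_vals[of I p] that by (auto simp: outcome_def)
  then have "range ?r \<subseteq> PiE ?V (\<lambda>_. vals I)"
    by (intro image_subsetI restrict_PiE_iff[THEN iffD2]) blast
  then have "finite (range ?r)"
    by (rule finite_subset) (intro finite_PiE finite_set_values_pmf finite_vals assms)
  then have "finite ((\<lambda>r. map_pmf r (values_pmf I)) ` range ?r)"
    by (rule finite_imageI)
  moreover have "map_pmf (?r p) (values_pmf I) = outcome I p" for p
    unfolding outcome_def by (intro map_pmf_cong) auto
  ultimately show ?thesis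
    by (simp only: image_image)
qed

lemma set_max_pmf_subset_vals:
  assumes "finite_support_instance I"
  shows "set_pmf (max_pmf I) \<subseteq> vals I"
proof
  fix y assume "y \<in> set_pmf (max_pmf I)"
  then obtain v where v: "v \<in> set_pmf (values_pmf I)" "y = Max (v ` {..<length I})"
    by (auto simp: max_pmf_def)
  have "{..<length I} \<noteq> {}"
    using assms by (auto simp: finite_support_instance_def lessThan_empty_iff)
  then have "y \<in> v ` {..<length I}"
    unfolding v(2) by (intro Max_in) auto
  then show "y \<in> vals I"
    using values_in_vals[OF v(1)] by auto
qed

section \<open>Transforming the values by a monotone function\<close>

text \<open>Plays on values \<open>v\<close> as \<open>p\<close> plays on the values \<open>f (v i)\<close>; \<open>f\<close> need not be injective.\<close>

definition pullback_policy :: "(real \<Rightarrow> real) \<Rightarrow> policy \<Rightarrow> policy" where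
  "pullback_policy f p =
     Policy (\<lambda>h. next_item p (map (apsnd f) h)) (\<lambda>h x. accepts p (map (apsnd f) h) (f x))"

lemma valid_pullback_policy: "valid_policy n p \<Longrightarrow> valid_policy n (pullback_policy f p)"
  unfolding valid_policy_def pullback_policy_def
proof (intro allI impI, unfold policy.sel)
  fix h :: history
  have *: "fst ` set (map (apsnd f) h) = fst ` set h"
    by (force simp: image_image)
  assume "\<forall>h. {..<n} - fst ` set h \<noteq> {} \<longrightarrow> next_item p h \<in> {..<n} - fst ` set h"
    and "{..<n} - fst ` set h \<noteq> {}"
  then show "next_item p (map (apsnd f) h) \<in> {..<n} - fst ` set h"
    by (metis *)
qed

text \<open>Both runs ask for the same items and stop at the same time; \<open>f 0 = 0\<close>
  handles the run that accepts nothing.\<close>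

lemma run_pullback_policy:
  assumes "f 0 = 0"
  shows "f (run (pullback_policy f p) k h v) = run p k (map (apsnd f) h) (f \<circ> v)"
  using assms by (induction k arbitrary: h) (auto simp: Let_def pullback_policy_def)

context
  fixes I :: inst and f :: "real \<Rightarrow> real"
  assumes I: "finite_support_instance I" and f: "mono f" "f 0 = 0"
begin

lemma finite_support_map: "finite_support_instance (map (map_pmf f) I)"
  using I monoD[OF f(1), of 0] f(2) by (fastforce simp: finite_support_instance_def)

text \<open>\<open>f 0 = 0\<close> also makes \<open>f\<close> preserve the default value of
  \<open>Pi_pmf\<close>.\<close>

lemma values_pmf_map: "values_pmf (map (map_pmf f) I) = map_pmf (\<lambda>v. f \<circ> v) (values_pmf I)"
proof -
  have "values_pmf (map (map_pmf f) I) = Pi_pmf {..<length I} 0 (\<lambda>i. map_pmf f (I ! i))"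
    unfolding values_pmf_def by (intro Pi_pmf_cong) auto
  also have "\<dots> = map_pmf (\<lambda>v. f \<circ> v) (values_pmf I)"
    unfolding values_pmf_def by (intro Pi_pmf_map f(2)) auto
  finally show ?thesis .
qed

lemma max_pmf_map: "max_pmf (map (map_pmf f) I) = map_pmf f (max_pmf I)"
proof -
  have "{..<length I} \<noteq> {}"
    using I by (auto simp: finite_support_instance_def lessThan_empty_iff)
  then have "f (Max (v ` {..<length I})) = Max (f ` v ` {..<length I})" for v
    by (intro mono_Max_commute f(1)) auto
  then show ?thesis
    unfolding max_pmf_def values_pmf_map by (simp add: map_pmf_comp image_comp comp_def image_image)
qed

lemma outcome_map: "outcome (map (map_pmf f) I) p = map_pmf f (outcome I (pullback_policy f p))"
  unfolding outcome_def values_pmf_map by (simp add: map_pmf_comp run_pullback_policy[of f, OF f(2)])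

text \<open>On the transformed instance some policy drawn by \<open>A\<close> does at least as well
  as \<open>A\<close> on average; its pullback earns the same in terms of \<open>f\<close> on
  \<open>I\<close>.\<close>

lemma competitive_policy:
  assumes A: "order_selection_algorithm A" "competitive \<Gamma> A"
  obtains p where "valid_policy (length I) p"
    "\<Gamma> * measure_pmf.expectation (max_pmf I) f \<le> measure_pmf.expectation (outcome I p) f"
proof -
  let ?I = "map (map_pmf f) I"
  define B where "B = Max (abs ` vals ?I)"
  have "\<bar>y\<bar> \<le> B" if "y \<in> set_pmf (bind_pmf (A ?I) (outcome ?I))" for y
    unfolding B_def using that set_outcome_subset_vals finite_vals[OF finite_support_map]
    by (intro Max_ge) auto
  then obtain p where p: "p \<in> set_pmf (A ?I)"
    "measure_pmf.expectation (bind_pmf (A ?I) (outcome ?I)) (\<lambda>x. x)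
      \<le> measure_pmf.expectation (outcome ?I p) (\<lambda>x. x)"
    by (rule exists_expectation_ge)
  have "\<Gamma> * measure_pmf.expectation (max_pmf ?I) (\<lambda>x. x)
      \<le> measure_pmf.expectation (alg_pmf A ?I) (\<lambda>x. x)"
    using A(2) finite_support_map by (simp add: competitive_def)
  with p(2) have "\<Gamma> * measure_pmf.expectation (max_pmf I) f
      \<le> measure_pmf.expectation (outcome I (pullback_policy f p)) f"
    by (simp add: alg_pmf_eq_bind max_pmf_map outcome_map)
  moreover have "valid_policy (length I) p"
    using A(1) finite_support_map p(1) by (fastforce simp: order_selection_algorithm_def)
  then have "valid_policy (length I) (pullback_policy f p)"
    by (rule valid_pullback_policy)
  ultimately show thesis
    using that by blast
qed

end

section \<open>From weighted thresholds to approximate stochastic dominance\<close>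

lemma expectation_threshold_sum:
  fixes D :: "real pmf"
  shows "measure_pmf.expectation D (\<lambda>y. \<Sum>s\<in>J. w s * indicator {s<..} y)
    = (\<Sum>s\<in>J. w s * measure_pmf.prob D {s<..})"
  by (subst Bochner_Integration.integral_sum) (auto intro: measure_pmf.integrable_const_bound[where B = 1])

lemma ASD_policy_distribution:
  assumes A: "order_selection_algorithm A" "competitive \<Gamma> A"
    and I: "finite_support_instance I"
  obtains Q where "\<And>p. p \<in> set_pmf Q \<Longrightarrow> valid_policy (length I) p"
    "\<And>x. x > 0 \<Longrightarrow> \<Gamma> * measure_pmf.prob (max_pmf I) {x<..}
      \<le> measure_pmf.prob (bind_pmf Q (outcome I)) {x<..}"
proof -
  \<comment> \<open>\<open>M p s\<close> is the slack of the dominance inequality at threshold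
    \<open>s\<close>, so a mixture with nonnegative expected slack at every \<open>s\<close> is the
    goal.\<close>
  define M where "M p s = measure_pmf.prob (outcome I p) {s<..}
    - \<Gamma> * measure_pmf.prob (max_pmf I) {s<..}" for p s
  let ?F = "{p. valid_policy (length I) p}"
  have "M = (\<lambda>D s. measure_pmf.prob D {s<..} - \<Gamma> * measure_pmf.prob (max_pmf I) {s<..}) \<circ> outcome I"
    by (auto simp: M_def fun_eq_iff)
  then have "finite (range M)"
    using finite_imageI[OF finite_range_outcome[OF I]] by (simp only: image_comp)
  then have fin: "finite (M ` ?F)"
    by (rule finite_subset[rotated]) auto
  have resp: "\<exists>p\<in>?F. (\<Sum>s\<in>vals I. w s * M p s) \<ge> 0" if w: "\<And>s. w s \<ge> 0" for w
  proof -
    define f :: "real \<Rightarrow> real" where "f y = (\<Sum>s\<in>vals I. w s * indicator {s<..} y)" for y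
    have "mono f"
      unfolding f_def
      by (intro monoI sum_mono mult_left_mono w) (auto simp: indicator_def)
    \<comment> \<open>All thresholds are nonnegative, so none lies strictly below 0.\<close>
    moreover have "f 0 = 0"
      unfolding f_def
      by (intro sum.neutral) (auto simp: indicator_def dest!: vals_nonneg[OF I])
    ultimately obtain p where "valid_policy (length I) p"
      "\<Gamma> * measure_pmf.expectation (max_pmf I) f \<le> measure_pmf.expectation (outcome I p) f"
      using competitive_policy[OF I _ _ A] by blast
    \<comment> \<open>Expectations of \<open>f\<close> are weighted sums of tail probabilities, so
      the inequality for \<open>f\<close> is the weighted sum of slacks.\<close>
    then show ?thesis
      unfolding f_def expectation_threshold_sum M_def
      by (intro bexI[of _ p]) (auto simp: algebra_simps sum_subtractf sum_distrib_left)
  qed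
  obtain Q where Q: "finite (set_pmf Q)" "set_pmf Q \<subseteq> ?F"
    and ge: "\<And>s. s \<in> vals I \<Longrightarrow> measure_pmf.expectation Q (\<lambda>p. M p s) \<ge> 0"
    using minimax_pmf[OF fin finite_vals[OF I] resp] by blast
  have bind: "measure_pmf.prob (bind_pmf Q (outcome I)) X
      = measure_pmf.expectation Q (\<lambda>p. measure_pmf.prob (outcome I p) X)" for X
    using expectation_bind_pmf(1)[of Q "outcome I" "indicator X" 1] by (simp add: indicator_def)
  show thesis
  proof (rule that[of Q])
    fix x :: real assume "x > 0"
    \<comment> \<open>Rounding x down to a possible value leaves no value in (s, x], so the tail
      events at x and \<open>s\<close> agree almost surely.\<close>
    define s where "s = Max {s \<in> vals I. s \<le> x}"
    have fin_below: "finite {s \<in> vals I. s \<le> x}" and "0 \<in> {s \<in> vals I. s \<le> x}"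
      using finite_vals[OF I] \<open>x > 0\<close> by (auto simp: vals_def)
    then have "s \<in> {s \<in> vals I. s \<le> x}"
      unfolding s_def by (intro Max_in) blast+
    then have s: "s \<in> vals I" "s \<le> x"
      by auto
    have "y \<le> s" if "y \<in> vals I" "y \<le> x" for y
      unfolding s_def using that fin_below by (intro Max_ge) auto
    with s have iff: "x < y \<longleftrightarrow> s < y" if "y \<in> vals I" for y
      using that by (meson leD leI le_less_trans)
    have threshold: "measure_pmf.prob D {x<..} = measure_pmf.prob D {s<..}"
      if "set_pmf D \<subseteq> vals I" for D
      using that iff by (intro measure_pmf.finite_measure_eq_AE) (auto simp: AE_measure_pmf_iff)
    have "measure_pmf.expectation Q (\<lambda>p. M p s)
        = measure_pmf.prob (bind_pmf Q (outcome I)) {s<..} - \<Gamma> * measure_pmf.prob (max_pmf I) {s<..}"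
      unfolding M_def bind by (simp add: integrable_measure_pmf_finite[OF Q(1)])
    with ge[OF s(1)] have "\<Gamma> * measure_pmf.prob (max_pmf I) {s<..}
        \<le> measure_pmf.prob (bind_pmf Q (outcome I)) {s<..}"
      by simp
    moreover have "set_pmf (bind_pmf Q (outcome I)) \<subseteq> vals I"
      using set_outcome_subset_vals by auto
    ultimately show "\<Gamma> * measure_pmf.prob (max_pmf I) {x<..}
        \<le> measure_pmf.prob (bind_pmf Q (outcome I)) {x<..}"
      using set_max_pmf_subset_vals[OF I] by (simp only: threshold)
  qed (use Q(2) in auto)
qed

theorem theorem2:
  fixes \<Gamma> :: real
  assumes "\<exists>A. order_selection_algorithm A \<and> competitive \<Gamma> A"
  shows "\<exists>A. order_selection_algorithm A \<and> ASD \<Gamma> A"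
proof -
  obtain A where A: "order_selection_algorithm A" "competitive \<Gamma> A"
    using assms by blast
  have "\<exists>Q. finite_support_instance I \<longrightarrow> (\<forall>p\<in>set_pmf Q. valid_policy (length I) p) \<and>
      (\<forall>x>0. \<Gamma> * measure_pmf.prob (max_pmf I) {x<..}
        \<le> measure_pmf.prob (bind_pmf Q (outcome I)) {x<..})" for I
    using ASD_policy_distribution[OF A] by metis
  then obtain A' where "\<And>I. finite_support_instance I \<Longrightarrow>
      (\<forall>p\<in>set_pmf (A' I). valid_policy (length I) p) \<and>
      (\<forall>x>0. \<Gamma> * measure_pmf.prob (max_pmf I) {x<..}
        \<le> measure_pmf.prob (bind_pmf (A' I) (outcome I)) {x<..})"
    by metis
  then have "order_selection_algorithm A' \<and> ASD \<Gamma> A'"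
    by (auto simp: order_selection_algorithm_def ASD_def alg_pmf_eq_bind)
  then show ?thesis by blast
qed

end
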